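(* Let $A\in\mathbb{R}[\mathtt{x}]^{\alpha\times\alpha}$ be a linear pencil in the variables $\mathtt{x}=(\mathtt{x}_1,\dots,\mathtt{x}_n)$. Then for all $f\in\mathbb{R}[\mathtt{x}]_1$, $$f\ge0\ \text{ on }\ S_A\quad\Longleftrightarrow\quad f\in C_A+\sqrt{\operatorname{supp}M_A}.$$
   Context: Let $\mathtt{x}=(\mathtt{x}_1,\dots,\mathtt{x}_n)$ be commuting variables, $\mathbb{R}[\mathtt{x}]$ the polynomial ring and $\mathbb{R}[\mathtt{x}]_1$ the space of polynomials of degree at most $1$. A linear pencil of size $\alpha$ is a symmetric matrix $A\in\mathbb{R}[\mathtt{x}]^{\alpha\times\alpha}$ with entries in $\mathbb{R}[\mathtt{x}]_1$; its spectrahedron is $S_A:=\{x\in\mathbb{R}^n\mid A(x)\succeq0\}$ ($\succeq0$ means positive semidefinite). Define $$C_A:=\Big\{c+\sum_iu_i^*Au_i\ \Big|\ c\in\mathbb{R}_{\ge0},\ u_i\in\mathbb{R}^\alpha\Big\}\subseteq\mathbb{R}[\mathtt{x}]_1,\qquad M_A:=\Big\{s+\sum_iv_i^*Av_i\ \Big|\ s\in\sum\mathbb{R}[\mathtt{x}]^2,\ v_i\in\mathbb{R}[\mathtt{x}]^\alpha\Big\}\subseteq\mathbb{R}[\mathtt{x}]$$ (finite sums; $^*$ is transpose; $\sum\mathbb{R}[\mathtt{x}]^2$ is the set of finite sums of squares of polynomials). $M_A$ is a quadratic module, i.e. it contains $1$, is closed under addition and under multiplication by squares of elements of $\mathbb{R}[\mathtt{x}]$;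 its support $\operatorname{supp}M_A:=M_A\cap(-M_A)$ is an ideal of $\mathbb{R}[\mathtt{x}]$. For an ideal $\mathcal{I}$, $\sqrt{\mathcal{I}}:=\{f\in\mathbb{R}[\mathtt{x}]\mid\exists k\in\mathbb{N}: f^k\in\mathcal{I}\}$ with $\mathbb{N}=\{1,2,\dots\}$. *)

theory Defs
  imports "HOL-Analysis.Analysis" "HOL-Library.Poly_Mapping" "HOL-Library.Set_Algebras"
begin

text \<open>Real polynomials in commuting variables indexed by the finite type \<open>'n\<close>: finitely supported
  maps from exponent vectors to coefficients, with the convolution product of
  \<^theory>\<open>HOL-Library.Poly_Mapping\<close>.\<close>

type_synonym 'n rpoly = "('n \<Rightarrow>\<^sub>0 nat) \<Rightarrow>\<^sub>0 real"

definition const_poly :: "real \<Rightarrow> 'n rpoly" where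
  "const_poly c = Poly_Mapping.single 0 c"

definition eval_poly :: "'n::finite rpoly \<Rightarrow> real ^ 'n \<Rightarrow> real" where
  "eval_poly p x =
     (\<Sum>m\<in>Poly_Mapping.keys p.
        Poly_Mapping.lookup p m * (\<Prod>i\<in>UNIV. (x $ i) ^ Poly_Mapping.lookup m i))"

definition polys_deg_le :: "nat \<Rightarrow> 'n::finite rpoly set" where
  "polys_deg_le d =
     {p. \<forall>m\<in>Poly_Mapping.keys p. (\<Sum>i\<in>UNIV. Poly_Mapping.lookup m i) \<le> d}"

definition linear_pencil :: "'n::finite rpoly ^ 'a::finite ^ 'a \<Rightarrow> bool" where
  "linear_pencil A \<longleftrightarrow> transpose A = A \<and> (\<forall>i j. A $ i $ j \<in> polys_deg_le 1)"

definition eval_pencil ::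
    "'n::finite rpoly ^ 'a::finite ^ 'a \<Rightarrow> real ^ 'n \<Rightarrow> real ^ 'a ^ 'a" where
  "eval_pencil A x = (\<chi> i j. eval_poly (A $ i $ j) x)"

definition pos_semidef :: "real ^ 'a::finite ^ 'a \<Rightarrow> bool" where
  "pos_semidef M \<longleftrightarrow> transpose M = M \<and> (\<forall>v. 0 \<le> v \<bullet> (M *v v))"

definition spectrahedron :: "'n::finite rpoly ^ 'a::finite ^ 'a \<Rightarrow> (real ^ 'n) set" where
  "spectrahedron A = {x. pos_semidef (eval_pencil A x)}"

text \<open>\<open>v\<^sup>* A v\<close>; the inner product of HOL-Analysis is not available over polynomials.\<close>

definition quad_form :: "'r::comm_ring_1 ^ 'a::finite ^ 'a \<Rightarrow> 'r ^ 'a \<Rightarrow> 'r" where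
  "quad_form A v = (\<Sum>i\<in>UNIV. v $ i * (A *v v) $ i)"

definition const_vec :: "real ^ 'a::finite \<Rightarrow> 'n rpoly ^ 'a" where
  "const_vec u = (\<chi> i. const_poly (u $ i))"

definition sums_of_squares :: "'r::comm_ring_1 set" where
  "sums_of_squares = {s. \<exists>qs. s = (\<Sum>q\<leftarrow>qs. q\<^sup>2)}"

definition pencil_cone :: "'n::finite rpoly ^ 'a::finite ^ 'a \<Rightarrow> 'n rpoly set" where
  "pencil_cone A =
     {p. \<exists>c us. 0 \<le> c \<and> p = const_poly c + (\<Sum>u\<leftarrow>us. quad_form A (const_vec u))}"

definition pencil_module :: "'n::finite rpoly ^ 'a::finite ^ 'a \<Rightarrow> 'n rpoly set" where
  "pencil_module A =
     {p. \<exists>s vs. s \<in> sums_of_squares \<and> p = s + (\<Sum>v\<leftarrow>vs. quad_form A v)}"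

definition module_support :: "'r::comm_ring_1 set \<Rightarrow> 'r set" where
  "module_support M = M \<inter> uminus ` M"

definition ideal_radical :: "'r::comm_ring_1 set \<Rightarrow> 'r set" where
  "ideal_radical I = {f. \<exists>k::nat. 1 \<le> k \<and> f ^ k \<in> I}"

end

(*
  Put I = sqrt (supp M_A). If a sum of two elements of M_A lies in I, then so does each summand;
  and if u* A u lies in I, then so do all entries of A u. Hence, modulo I, the cone C_A is generated
  by 1 and the u* A u with u in the unit sphere of the orthogonal complement of {u. A u = 0 mod I},
  a compact set whose convex hull misses I unless 1 is in I. If f is not in C_A + I, then the convex
  hull of this set and -f still misses the affine part of I, and a strictly separating functional,
  normalised at 1, is evaluation at a point of S_A where f is negative.
*)

theory Submission
  imports Defs
begin

section \<open>Quadratic modules\<close>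

text \<open>Beyond commutativity the ring only needs an inverse of 2: \<open>half\<close> enters the
  polarisation, the cubic identity of \<open>nil_power_summand\<close> and the vector chosen in
  \<open>nil_matrix_vector\<close>.\<close>

locale quadratic_module =
  fixes M :: "'r::comm_ring_1 set" and half :: 'r
  assumes half: "half + half = 1"
    and one_mem: "1 \<in> M"
    and add_mem: "\<And>p q. p \<in> M \<Longrightarrow> q \<in> M \<Longrightarrow> p + q \<in> M"
    and square_mult_mem: "\<And>p s. p \<in> M \<Longrightarrow> s\<^sup>2 * p \<in> M"
begin

lemma zero_mem: "0 \<in> M"
  using square_mult_mem[OF one_mem, of 0] by simp

lemma square_mem: "s\<^sup>2 \<in> M"
  using square_mult_mem[OF one_mem, of s] by simp

lemma support_iff: "p \<in> module_support M \<longleftrightarrow> p \<in> M \<and> - p \<in> M"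
proof -
  have "p \<in> uminus ` M \<longleftrightarrow> - p \<in> M"
    by (metis image_iff minus_minus)
  then show ?thesis by (simp add: module_support_def)
qed

lemma support_add: "p \<in> module_support M \<Longrightarrow> q \<in> module_support M \<Longrightarrow> p + q \<in> module_support M"
  using add_mem[of "-p" "-q"] by (simp add: support_iff add_mem)

lemma support_minus: "p \<in> module_support M \<Longrightarrow> - p \<in> module_support M"
  by (simp add: support_iff)

lemma support_zero: "0 \<in> module_support M"
  by (simp add: support_iff zero_mem)

text \<open>Polarisation: \<open>q = ((q + 1) / 2)\<^sup>2 - ((q - 1) / 2)\<^sup>2\<close>.\<close>

lemma support_mult:
  assumes "p \<in> module_support M"
  shows "q * p \<in> module_support M"
proof -
  have sq: "s\<^sup>2 * p \<in> module_support M" for s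
    using assms square_mult_mem[of p s] square_mult_mem[of "-p" s] by (simp add: support_iff)
  have "(half * (q + 1))\<^sup>2 * p + - ((half * (q - 1))\<^sup>2 * p) = (half + half) * (half + half) * (q * p)"
    by (simp add: power2_eq_square algebra_simps)
  then have "q * p = (half * (q + 1))\<^sup>2 * p + - ((half * (q - 1))\<^sup>2 * p)"
    by (simp add: half)
  then show ?thesis
    using support_add support_minus sq by metis
qed

section \<open>The radical of the support\<close>

abbreviation nil :: "'r set" where
  "nil \<equiv> ideal_radical (module_support M)"

lemma nil_iff: "p \<in> nil \<longleftrightarrow> (\<exists>k\<ge>1. p ^ k \<in> module_support M)"
  by (auto simp: ideal_radical_def)

lemma nilI: "p ^ k \<in> module_support M \<Longrightarrow> p \<in> nil"
  using support_mult[of "p ^ k" p] by (auto simp: nil_iff intro!: exI[of _ "Suc k"])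

lemma nil_zero: "0 \<in> nil"
  by (rule nilI[of _ 1]) (simp add: support_zero)

lemma nil_mult: "p \<in> nil \<Longrightarrow> q * p \<in> nil"
  by (metis nilI nil_iff power_mult_distrib support_mult)

lemma nil_power_cancel: "p ^ k \<in> nil \<Longrightarrow> p \<in> nil"
  by (metis nilI nil_iff power_mult)

lemma support_sum: "(\<And>i. i \<in> S \<Longrightarrow> g i \<in> module_support M) \<Longrightarrow> sum g S \<in> module_support M"
  by (induction S rule: infinite_finite_induct) (auto simp: support_zero support_add)

lemma nil_add:
  assumes "p \<in> nil" "q \<in> nil"
  shows "p + q \<in> nil"
proof -
  obtain k l where k: "p ^ k \<in> module_support M" and l: "q ^ l \<in> module_support M"
    using assms by (auto simp: nil_iff)
  \<comment> \<open>Each term of the binomial expansion has at least k factors p or at least l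
    factors q.\<close>
  have "of_nat (k + l choose i) * p ^ i * q ^ (k + l - i) \<in> module_support M"
    if "i \<le> k + l" for i
  proof (cases "k \<le> i")
    case True
    then have "p ^ i = p ^ (i - k) * p ^ k" by (simp flip: power_add)
    then have "of_nat (k + l choose i) * p ^ i * q ^ (k + l - i)
        = of_nat (k + l choose i) * p ^ (i - k) * q ^ (k + l - i) * p ^ k"
      by (simp add: mult_ac)
    then show ?thesis using k support_mult by metis
  next
    case False
    then have "k + l - i = (k - i) + l" by simp
    then have "of_nat (k + l choose i) * p ^ i * q ^ (k + l - i)
        = of_nat (k + l choose i) * p ^ i * q ^ (k - i) * q ^ l"
      by (simp add: power_add mult.assoc)
    then show ?thesis using l support_mult by metis
  qed
  then have "(p + q) ^ (k + l) \<in> module_support M"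
    by (auto simp: binomial_ring intro!: support_sum)
  then show ?thesis by (rule nilI)
qed

lemma nil_sum: "(\<And>i. i \<in> S \<Longrightarrow> g i \<in> nil) \<Longrightarrow> sum g S \<in> nil"
  by (induction S rule: infinite_finite_induct) (auto simp: nil_zero nil_add)

text \<open>With \<open>h = p + q\<close> nilpotent modulo the support,
  \<open>(h - p) (p + h/2)\<^sup>2 = h\<^sup>2 (3 p + h) / 4 - p\<^sup>3\<close>; this trades \<open>(p, h)\<close> for
  \<open>(p\<^sup>3, h\<^sup>2 (3 p + h) / 4)\<close> and so halves the order of nilpotency.\<close>

lemma nil_power_summand:
  assumes "p \<in> M" "h - p \<in> M" "h ^ k \<in> module_support M"
  shows "p \<in> nil"
  using assms
proof (induction k arbitrary: p h rule: less_induct)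
  case (less k)
  show ?case
  proof (cases "k \<le> 1")
    \<comment> \<open>For k = 0 as well as k = 1, h itself lies in the support, so -p = (h - p) +
      (-h) lies in M.\<close>
    case True
    then have "h ^ 1 \<in> module_support M"
      using less.prems(3) support_mult[of 1 h] by (cases k) auto
    then have "- h \<in> M" by (simp add: support_iff)
    from add_mem[OF this less.prems(2)] have "p ^ 1 \<in> module_support M"
      using less.prems(1) by (simp add: support_iff)
    then show ?thesis by (rule nilI)
  next
    case False
    define h' where "h' = half\<^sup>2 * h\<^sup>2 * (3 * p + h)"
    \<comment> \<open>Half of k, rounded up: \<open>h'\<close> has the factor h^2, so
      \<open>h' ^ j\<close> has the factor h^(2j) and thus h^k.\<close>
    define j where "j = (k + 1) div 2"
    have "j < k" and j: "k \<le> 2 * j" using False by (auto simp: j_def)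
    have "h' ^ j = (half\<^sup>2 * (3 * p + h)) ^ j * h ^ (2 * j)"
      unfolding h'_def power_mult power_mult_distrib by (simp only: mult_ac)
    also have "h ^ (2 * j) = h ^ (2 * j - k) * h ^ k"
      using j by (simp flip: power_add)
    finally have "h' ^ j = ((half\<^sup>2 * (3 * p + h)) ^ j * h ^ (2 * j - k)) * h ^ k"
      by (simp add: mult.assoc)
    then have nil': "h' ^ j \<in> module_support M"
      using less.prems(3) support_mult by metis
    have p3: "p ^ 3 \<in> M"
      using square_mult_mem[OF less.prems(1), of p] by (simp add: power3_eq_cube power2_eq_square)
    have two: "2 * half = 1" by (simp only: mult_2 half)
    \<comment> \<open>This holds with \<open>half\<close> as a free symbol; the defect has the
      factor 1 - 2 \<open>half\<close>, which is 0.\<close>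
    have "(p + half * h)\<^sup>2 * (h - p) = (h' - p ^ 3) + (1 - 2 * half) * (p * p * h + 2 * half * p * h * h)"
      by (simp add: h'_def power2_eq_square power3_eq_cube algebra_simps)
    then have "(p + half * h)\<^sup>2 * (h - p) = h' - p ^ 3"
      by (simp add: two)
    then have q3: "h' - p ^ 3 \<in> M"
      using square_mult_mem[OF less.prems(2)] by metis
    show ?thesis
      using less.IH[OF \<open>j < k\<close> p3 q3 nil'] by (rule nil_power_cancel)
  qed
qed

text \<open>The radical is thus convex with respect to M. This drives both
  \<open>nil_matrix_vector\<close> and the convexity of the set of cone elements outside the
  radical.\<close>

lemma nil_summand:
  assumes "p \<in> M" "q \<in> M" "p + q \<in> nil"
  shows "p \<in> nil"
proof -
  obtain k where "(p + q) ^ k \<in> module_support M" using assms by (auto simp: nil_iff)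
  then show ?thesis using nil_power_summand[of p "p + q" k] assms by simp
qed

end

section \<open>Quadratic forms\<close>

lemma quad_form_sum: "quad_form A v = (\<Sum>i\<in>UNIV. \<Sum>j\<in>UNIV. v $ i * v $ j * A $ i $ j)"
  by (simp add: quad_form_def matrix_vector_mult_def sum_distrib_left mult_ac)

lemma quad_form_scale: "quad_form A (s *s v) = s\<^sup>2 * quad_form A v"
  by (simp add: quad_form_sum sum_distrib_left power2_eq_square mult_ac)

lemma transpose_eq_selfD: "transpose A = A \<Longrightarrow> A $ i $ j = A $ j $ i"
  by (drule arg_cong[of _ _ "\<lambda>B. B $ j $ i"]) (simp add: transpose_def)

lemma matrix_vector_mult_scale_nth:
  fixes A :: "'r::comm_ring_1 ^ 'a::finite ^ 'b"
  shows "(A *v (s *s v)) $ i = s * (A *v v) $ i"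
  by (simp add: matrix_vector_mult_def sum_distrib_left mult_ac)

text \<open>Symmetry merges the two cross terms. Writing them through \<open>A *v u\<close> shows
  that they lie in an ideal as soon as the entries of A u do.\<close>

lemma quad_form_add:
  fixes A :: "'r::comm_ring_1 ^ 'a::finite ^ 'a"
  assumes "transpose A = A"
  shows "quad_form A (u + w) = quad_form A u + 2 * (\<Sum>i\<in>UNIV. w $ i * (A *v u) $ i) + quad_form A w"
proof -
  note sym = transpose_eq_selfD[OF assms]
  have "(\<Sum>i\<in>UNIV. u $ i * (A *v w) $ i) = (\<Sum>i\<in>UNIV. \<Sum>j\<in>UNIV. u $ i * A $ i $ j * w $ j)"
    by (simp add: matrix_vector_mult_def sum_distrib_left mult_ac)
  also have "\<dots> = (\<Sum>j\<in>UNIV. \<Sum>i\<in>UNIV. u $ i * A $ i $ j * w $ j)"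
    by (rule sum.swap)
  also have "\<dots> = (\<Sum>j\<in>UNIV. \<Sum>i\<in>UNIV. w $ j * (A $ j $ i * u $ i))"
    by (intro sum.cong refl) (subst sym, simp add: mult_ac)
  also have "\<dots> = (\<Sum>i\<in>UNIV. w $ i * (A *v u) $ i)"
    by (simp add: matrix_vector_mult_def sum_distrib_left)
  finally have "(\<Sum>i\<in>UNIV. u $ i * (A *v w) $ i) = (\<Sum>i\<in>UNIV. w $ i * (A *v u) $ i)" .
  then show ?thesis
    by (simp add: quad_form_def matrix_vector_right_distrib algebra_simps sum.distrib)
qed

text \<open>With \<open>h = u\<^sup>* A u\<close>, \<open>g = (A u)\<^sub>i\<close>, \<open>b = A\<^sub>i\<^sub>i\<close> and \<open>t = - (b + 1) / 2\<close>, the value of the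
  form at \<open>t u + g e\<^sub>i\<close> is \<open>t\<^sup>2 h - g\<^sup>2\<close>.\<close>

lemma (in quadratic_module) nil_matrix_vector:
  fixes A :: "'r ^ 'a::finite ^ 'a"
  assumes sym: "transpose A = A" and forms: "\<And>v. quad_form A v \<in> M"
    and u: "quad_form A u \<in> nil"
  shows "(A *v u) $ i \<in> nil"
proof -
  define g where "g = (A *v u) $ i"
  define b where "b = quad_form A (axis i 1)"
  define t where "t = - (half * (b + 1))"
  have axis: "(g *s axis i 1) $ j * z j = (if j = i then g * z j else 0)" for j and z :: "'a \<Rightarrow> 'r"
    by (auto simp: axis_def)
  have "(\<Sum>j\<in>UNIV. (g *s axis i 1) $ j * (A *v (t *s u)) $ j) = g * (A *v (t *s u)) $ i"
    by (simp only: axis) simp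
  also have "(A *v (t *s u)) $ i = t * g"
    by (simp add: g_def matrix_vector_mult_scale_nth)
  finally have "quad_form A (t *s u + g *s axis i 1) = t\<^sup>2 * quad_form A u + 2 * (g * (t * g)) + g\<^sup>2 * b"
    by (simp only: quad_form_add[OF sym] quad_form_scale b_def)
  \<comment> \<open>The choice of \<open>t\<close> amounts to 2 t + b = -1.\<close>
  also have "\<dots> = t\<^sup>2 * quad_form A u - g\<^sup>2"
  proof -
    have "2 * half = 1" by (simp only: mult_2 half)
    moreover have "2 * (g * (t * g)) + g\<^sup>2 * b = (1 - 2 * half) * (g\<^sup>2 * (b + 1)) - g\<^sup>2"
      by (simp add: t_def power2_eq_square algebra_simps)
    ultimately show ?thesis by (simp add: add.assoc)
  qed
  finally have "t\<^sup>2 * quad_form A u - g\<^sup>2 \<in> M" using forms by metis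
  \<comment> \<open>Here g^2 and t^2 h - g^2 are elements of M whose sum t^2 h lies in the
    radical.\<close>
  then have "g\<^sup>2 \<in> nil"
    using nil_summand[OF square_mem[of g]] nil_mult[OF u] by simp
  then show ?thesis unfolding g_def by (rule nil_power_cancel)
qed

section \<open>Polynomials\<close>

lemma const_poly_simps:
  "const_poly 0 = 0" "const_poly 1 = 1"
  "const_poly (a + b) = const_poly a + const_poly b"
  "const_poly (- a) = - const_poly a"
  "const_poly (a * b) = const_poly a * const_poly b"
  by (simp_all add: const_poly_def single_add mult_single single_uminus)

lemma lookup_const_poly_mult [simp]:
  "Poly_Mapping.lookup (const_poly c * p) m = c * Poly_Mapping.lookup p m"
  unfolding const_poly_def mult_map_scale_conv_mult[symmetric]
  by (simp add: Poly_Mapping.map.rep_eq when_def)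

lemma const_poly_eq_square: "0 \<le> c \<Longrightarrow> const_poly c = (const_poly (sqrt c))\<^sup>2"
  by (simp add: power2_eq_square flip: const_poly_simps)

lemma poly_sum_monomials:
  "p = (\<Sum>m\<in>Poly_Mapping.keys p. Poly_Mapping.single m (Poly_Mapping.lookup p m))"
  by (rule poly_mapping_eqI) (auto simp: lookup_sum lookup_single when_def in_keys_iff)

definition eval_monom :: "('n::finite \<Rightarrow>\<^sub>0 nat) \<Rightarrow> real ^ 'n \<Rightarrow> real" where
  "eval_monom m x = (\<Prod>i\<in>UNIV. (x $ i) ^ Poly_Mapping.lookup m i)"

lemma eval_monom_add: "eval_monom (m + k) x = eval_monom m x * eval_monom k x"
  by (simp add: eval_monom_def lookup_add power_add prod.distrib)

text \<open>Cancellation can shrink the keys of a sum, so additivity of evaluation needs a common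
  index set; the extra exponents have coefficient 0.\<close>

lemma eval_poly_superset:
  assumes "finite S" "Poly_Mapping.keys p \<subseteq> S"
  shows "eval_poly p x = (\<Sum>m\<in>S. Poly_Mapping.lookup p m * eval_monom m x)"
  unfolding eval_poly_def eval_monom_def
  by (rule sum.mono_neutral_left) (use assms in \<open>auto simp: in_keys_iff\<close>)

lemma eval_poly_single: "eval_poly (Poly_Mapping.single m c) x = c * eval_monom m x"
  by (subst eval_poly_superset[of "{m}"]) auto

lemma eval_poly_add: "eval_poly (p + q) x = eval_poly p x + eval_poly q x"
proof -
  let ?S = "Poly_Mapping.keys p \<union> Poly_Mapping.keys q"
  have "Poly_Mapping.keys (p + q) \<subseteq> ?S" by (rule keys_add)
  then show ?thesis
    by (simp add: eval_poly_superset[of ?S] lookup_add algebra_simps sum.distrib)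
qed

lemma eval_poly_zero [simp]: "eval_poly 0 x = 0"
  by (simp add: eval_poly_def)

lemma eval_poly_const: "eval_poly (const_poly c) x = c"
  by (simp add: const_poly_def eval_poly_single eval_monom_def)

lemma eval_poly_minus: "eval_poly (- p) x = - eval_poly p x"
  using eval_poly_add[of p "-p" x] by simp

lemma eval_poly_sum: "eval_poly (sum g S) x = (\<Sum>i\<in>S. eval_poly (g i) x)"
  by (induction S rule: infinite_finite_induct) (auto simp: eval_poly_add)

lemma eval_poly_sum_list: "eval_poly (\<Sum>a\<leftarrow>as. g a) x = (\<Sum>a\<leftarrow>as. eval_poly (g a) x)"
  by (induction as) (auto simp: eval_poly_add)

text \<open>By bilinearity it suffices to treat single terms, where \<open>eval_monom_add\<close>
  applies.\<close>

lemma eval_poly_mult: "eval_poly (p * q) x = eval_poly p x * eval_poly q x"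
proof -
  let ?m = "\<lambda>p m. Poly_Mapping.single m (Poly_Mapping.lookup p m)"
  have *: "eval_poly p x = (\<Sum>m\<in>Poly_Mapping.keys p. eval_poly (?m p m) x)" for p :: "'a rpoly"
    by (subst poly_sum_monomials) (rule eval_poly_sum)
  have "p * q = (\<Sum>m\<in>Poly_Mapping.keys p. \<Sum>k\<in>Poly_Mapping.keys q. ?m p m * ?m q k)"
    by (simp add: poly_sum_monomials[symmetric] flip: sum_product)
  then have "eval_poly (p * q) x
      = (\<Sum>m\<in>Poly_Mapping.keys p. \<Sum>k\<in>Poly_Mapping.keys q. eval_poly (?m p m * ?m q k) x)"
    by (simp add: eval_poly_sum)
  also have "\<dots> = eval_poly p x * eval_poly q x"
    unfolding *[of p] *[of q] sum_product
    by (simp add: mult_single eval_poly_single eval_monom_add mult_ac)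
  finally show ?thesis .
qed

lemma eval_poly_power: "eval_poly (p ^ k) x = eval_poly p x ^ k"
  by (induction k) (simp_all add: eval_poly_mult eval_poly_const flip: const_poly_simps(2))

section \<open>Affine polynomials as vectors\<close>

text \<open>Places affine polynomials in a Euclidean space, where compactness and separation are
  available. Higher coefficients are dropped, so linearity holds for all polynomials and injectivity
  only in degree at most 1.\<close>

definition coeff_vec :: "'n::finite rpoly \<Rightarrow> real \<times> (real ^ 'n)" where
  "coeff_vec p =
     (Poly_Mapping.lookup p 0, \<chi> i. Poly_Mapping.lookup p (Poly_Mapping.single i 1))"

lemma coeff_vec_add: "coeff_vec (p + q) = coeff_vec p + coeff_vec q"
  by (simp add: coeff_vec_def lookup_add vec_eq_iff)

lemma coeff_vec_zero: "coeff_vec 0 = 0"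
  by (simp add: coeff_vec_def vec_eq_iff zero_prod_def)

lemma single_one_neq_zero: "Poly_Mapping.single i (1::nat) \<noteq> 0"
  by (rule notI, drule arg_cong[of _ _ Poly_Mapping.keys]) simp

lemma coeff_vec_one: "coeff_vec 1 = (1, 0)"
  by (simp add: coeff_vec_def vec_eq_iff lookup_one single_one_neq_zero del: One_nat_def)

lemma coeff_vec_minus: "coeff_vec (- p) = - coeff_vec p"
  by (simp add: coeff_vec_def vec_eq_iff)

lemma coeff_vec_scale: "coeff_vec (const_poly c * p) = c *\<^sub>R coeff_vec p"
  by (simp add: coeff_vec_def vec_eq_iff)

lemma coeff_vec_sum: "coeff_vec (sum g S) = (\<Sum>i\<in>S. coeff_vec (g i))"
  by (induction S rule: infinite_finite_induct) (auto simp: coeff_vec_add coeff_vec_zero)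

lemma degree_le_one_monom:
  fixes m :: "'n::finite \<Rightarrow>\<^sub>0 nat"
  assumes "(\<Sum>i\<in>UNIV. Poly_Mapping.lookup m i) \<le> 1"
  shows "m \<in> insert 0 (range (\<lambda>i. Poly_Mapping.single i 1))"
proof (cases "m = 0")
  case False
  then obtain i where i: "Poly_Mapping.lookup m i \<noteq> 0"
    by (metis poly_mapping_eqI lookup_zero)
  have "Poly_Mapping.lookup m i + (\<Sum>j\<in>UNIV - {i}. Poly_Mapping.lookup m j) \<le> 1"
    using assms by (simp add: sum.remove[of UNIV i])
  \<comment> \<open>One nonzero exponent already exhausts the degree bound.\<close>
  with i have "Poly_Mapping.lookup m i = 1" "(\<Sum>j\<in>UNIV - {i}. Poly_Mapping.lookup m j) = 0"
    by linarith+
  then have "m = Poly_Mapping.single i 1"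
    by (intro poly_mapping_eqI) (auto simp: lookup_single when_def)
  then show ?thesis by auto
qed simp

lemma keys_affine:
  "p \<in> polys_deg_le 1 \<Longrightarrow>
    Poly_Mapping.keys p \<subseteq> insert 0 (range (\<lambda>i. Poly_Mapping.single i 1))"
  using degree_le_one_monom by (fastforce simp: polys_deg_le_def)

lemma coeff_vec_inj:
  assumes "p \<in> polys_deg_le 1" "q \<in> polys_deg_le 1" "coeff_vec p = coeff_vec q"
  shows "p = q"
proof (rule poly_mapping_eqI)
  fix m
  show "Poly_Mapping.lookup p m = Poly_Mapping.lookup q m"
  proof (cases "m \<in> insert 0 (range (\<lambda>i. Poly_Mapping.single i 1))")
    case True
    then show ?thesis using assms(3) by (auto simp: coeff_vec_def vec_eq_iff)
  next
    case False
    then have "m \<notin> Poly_Mapping.keys p" "m \<notin> Poly_Mapping.keys q"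
      using assms(1,2) keys_affine by blast+
    then show ?thesis by (simp add: in_keys_iff)
  qed
qed

text \<open>Evaluation at x is the inner product with (1, x). Read backwards, a functional with
  positive first component is a multiple of an evaluation.\<close>

lemma eval_affine:
  assumes "p \<in> polys_deg_le 1"
  shows "eval_poly p x = fst (coeff_vec p) + snd (coeff_vec p) \<bullet> x"
proof -
  let ?s = "\<lambda>i::'a. Poly_Mapping.single i (1::nat)"
  have inj: "inj ?s"
    by (rule injI, drule arg_cong[of _ _ Poly_Mapping.keys]) simp
  have nz: "0 \<notin> range ?s"
    by (auto simp: single_one_neq_zero single_one_neq_zero[symmetric] simp del: One_nat_def)
  have var: "eval_monom (?s i) x = x $ i" for i
  proof -
    have "eval_monom (?s i) x = (\<Prod>j\<in>UNIV. if j = i then x $ j else 1)"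
      unfolding eval_monom_def by (rule prod.cong) (auto simp: lookup_single when_def)
    then show ?thesis by simp
  qed
  have "eval_poly p x = (\<Sum>m\<in>insert 0 (range ?s). Poly_Mapping.lookup p m * eval_monom m x)"
    by (rule eval_poly_superset) (use keys_affine[OF assms] in auto)
  also have "\<dots> = Poly_Mapping.lookup p 0 + (\<Sum>m\<in>range ?s. Poly_Mapping.lookup p m * eval_monom m x)"
    using nz by (simp add: eval_monom_def)
  also have "(\<Sum>m\<in>range ?s. Poly_Mapping.lookup p m * eval_monom m x)
      = (\<Sum>i\<in>UNIV. Poly_Mapping.lookup p (?s i) * x $ i)"
    by (subst sum.reindex[OF inj]) (simp only: o_def var)
  finally show ?thesis by (simp add: coeff_vec_def inner_vec_def)
qed

lemma affine_add: "p \<in> polys_deg_le d \<Longrightarrow> q \<in> polys_deg_le d \<Longrightarrow> p + q \<in> polys_deg_le d"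
  using keys_add[of p q] by (force simp: polys_deg_le_def)

lemma affine_zero: "0 \<in> polys_deg_le d"
  by (simp add: polys_deg_le_def)

lemma affine_scale: "p \<in> polys_deg_le d \<Longrightarrow> const_poly c * p \<in> polys_deg_le d"
  by (auto simp: polys_deg_le_def in_keys_iff)

lemma affine_const: "const_poly c \<in> polys_deg_le d"
  by (auto simp: polys_deg_le_def const_poly_def split: if_splits)

lemma affine_minus: "p \<in> polys_deg_le d \<Longrightarrow> - p \<in> polys_deg_le d"
  using affine_scale[of p d "-1"] by (simp add: const_poly_simps)

lemma affine_sum: "(\<And>i. i \<in> S \<Longrightarrow> g i \<in> polys_deg_le d) \<Longrightarrow> sum g S \<in> polys_deg_le d"
  by (induction S rule: infinite_finite_induct) (auto simp: affine_zero affine_add)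

lemma affine_sum_list: "(\<And>a. g a \<in> polys_deg_le d) \<Longrightarrow> (\<Sum>a\<leftarrow>as. g a) \<in> polys_deg_le d"
  by (induction as) (auto simp: affine_zero affine_add)

section \<open>The cone and the quadratic module of a pencil\<close>

lemma quadratic_module_pencil: "quadratic_module (pencil_module A) (const_poly (1/2))"
proof
  show "const_poly (1/2) + const_poly (1/2) = (1 :: 'a rpoly)"
    by (simp flip: const_poly_simps)
  have "(1 :: 'a rpoly) \<in> sums_of_squares"
    unfolding sums_of_squares_def by (auto intro!: exI[of _ "[1]"])
  then show "1 \<in> pencil_module A"
    unfolding pencil_module_def by (auto intro!: exI[of _ 1] exI[of _ "[]"])
next
  fix p q assume "p \<in> pencil_module A" "q \<in> pencil_module A"
  then obtain qs vs qs' vs' where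
    "p = (\<Sum>q\<leftarrow>qs. q\<^sup>2) + (\<Sum>v\<leftarrow>vs. quad_form A v)" "q = (\<Sum>q\<leftarrow>qs'. q\<^sup>2) + (\<Sum>v\<leftarrow>vs'. quad_form A v)"
    by (auto simp: pencil_module_def sums_of_squares_def)
  then have "p + q = (\<Sum>q\<leftarrow>qs @ qs'. q\<^sup>2) + (\<Sum>v\<leftarrow>vs @ vs'. quad_form A v)"
    by (simp add: algebra_simps)
  then show "p + q \<in> pencil_module A"
    unfolding pencil_module_def sums_of_squares_def by blast
next
  fix p s assume "p \<in> pencil_module A"
  then obtain qs vs where
    "p = (\<Sum>q\<leftarrow>qs. q\<^sup>2) + (\<Sum>v\<leftarrow>vs. quad_form A v)"
    by (auto simp: pencil_module_def sums_of_squares_def)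
  \<comment> \<open>The factor s is absorbed into every square and every vector.\<close>
  then have "s\<^sup>2 * p = (\<Sum>q\<leftarrow>map ((*) s) qs. q\<^sup>2) + (\<Sum>v\<leftarrow>map ((*s) s) vs. quad_form A v)"
    by (simp add: quad_form_scale sum_list_const_mult distrib_left power_mult_distrib o_def)
  then show "s\<^sup>2 * p \<in> pencil_module A"
    unfolding pencil_module_def sums_of_squares_def by blast
qed

lemma quad_form_in_pencil_module: "quad_form A v \<in> pencil_module A"
  unfolding pencil_module_def sums_of_squares_def
  by (auto intro!: exI[of _ "[]"] exI[of _ "[v]"])

lemma pencil_cone_subset_module: "pencil_cone A \<subseteq> pencil_module A"
proof
  fix p assume "p \<in> pencil_cone A"
  then obtain c us where c: "0 \<le> c"
    and p: "p = const_poly c + (\<Sum>u\<leftarrow>us. quad_form A (const_vec u))"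
    by (auto simp: pencil_cone_def)
  have "const_poly c \<in> sums_of_squares"
    unfolding sums_of_squares_def
    using const_poly_eq_square[OF c] by (auto intro!: exI[of _ "[const_poly (sqrt c)]"])
  moreover have "p = const_poly c + (\<Sum>v\<leftarrow>map const_vec us. quad_form A v)"
    by (simp add: p o_def)
  ultimately show "p \<in> pencil_module A" unfolding pencil_module_def by blast
qed

lemma pencil_cone_add:
  assumes "p \<in> pencil_cone A" "q \<in> pencil_cone A"
  shows "p + q \<in> pencil_cone A"
proof -
  obtain c us d ws where
    "0 \<le> c" "p = const_poly c + (\<Sum>u\<leftarrow>us. quad_form A (const_vec u))"
    "0 \<le> d" "q = const_poly d + (\<Sum>u\<leftarrow>ws. quad_form A (const_vec u))"
    using assms by (auto simp: pencil_cone_def)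
  then have "0 \<le> c + d" "p + q = const_poly (c + d) + (\<Sum>u\<leftarrow>us @ ws. quad_form A (const_vec u))"
    by (auto simp: const_poly_simps algebra_simps)
  then show ?thesis unfolding pencil_cone_def by blast
qed

lemma const_vec_scaleR: "const_vec (c *\<^sub>R u) = const_poly c *s const_vec u"
  by (simp add: const_vec_def vec_eq_iff const_poly_simps)

lemma const_vec_add: "const_vec (u + w) = const_vec u + const_vec w"
  by (simp add: const_vec_def vec_eq_iff const_poly_simps)

text \<open>A factor r on a form is absorbed as \<open>sqrt r\<close> in its vector.\<close>

lemma pencil_cone_scale:
  assumes "p \<in> pencil_cone A" "0 \<le> r"
  shows "const_poly r * p \<in> pencil_cone A"
proof -
  obtain c us where
    c: "0 \<le> c" and p: "p = const_poly c + (\<Sum>u\<leftarrow>us. quad_form A (const_vec u))"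
    using assms by (auto simp: pencil_cone_def)
  have "const_poly r * quad_form A (const_vec u) = quad_form A (const_vec (sqrt r *\<^sub>R u))" for u
    by (simp add: const_vec_scaleR quad_form_scale const_poly_eq_square[OF assms(2)])
  then have "const_poly r * p
      = const_poly (r * c) + (\<Sum>u\<leftarrow>map (\<lambda>u. sqrt r *\<^sub>R u) us. quad_form A (const_vec u))"
    by (simp add: p distrib_left const_poly_simps o_def flip: sum_list_const_mult)
  moreover have "0 \<le> r * c" using c assms(2) by simp
  ultimately show ?thesis unfolding pencil_cone_def by blast
qed

lemma pencil_cone_const: "0 \<le> c \<Longrightarrow> const_poly c \<in> pencil_cone A"
  unfolding pencil_cone_def by (auto intro!: exI[of _ c] exI[of _ "[]"])

lemma quad_form_in_pencil_cone: "quad_form A (const_vec u) \<in> pencil_cone A"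
  unfolding pencil_cone_def by (auto intro!: exI[of _ 0] exI[of _ "[u]"] simp: const_poly_simps)

lemma affine_quad_form:
  "linear_pencil A \<Longrightarrow> quad_form A (const_vec u) \<in> polys_deg_le 1"
  unfolding quad_form_sum const_vec_def linear_pencil_def
  by (auto intro!: affine_sum affine_scale simp flip: const_poly_simps)

lemma affine_pencil_cone: "linear_pencil A \<Longrightarrow> pencil_cone A \<subseteq> polys_deg_le 1"
  unfolding pencil_cone_def
  by (intro subsetI) (elim CollectE exE conjE, simp only:,
      intro affine_add affine_const affine_sum_list affine_quad_form)

section \<open>Values on the spectrahedron\<close>

lemma eval_quad_form:
  "eval_poly (quad_form A v) x
     = (\<chi> i. eval_poly (v $ i) x) \<bullet> (eval_pencil A x *v (\<chi> i. eval_poly (v $ i) x))"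
  by (simp add: quad_form_def matrix_vector_mult_def eval_pencil_def inner_vec_def
      eval_poly_sum eval_poly_mult)

lemma eval_quad_form_const:
  "eval_poly (quad_form A (const_vec u)) x = u \<bullet> (eval_pencil A x *v u)"
  by (simp add: eval_quad_form const_vec_def eval_poly_const)

text \<open>The value of v* A v at x is the form of the positive semidefinite matrix A(x) at the
  vector v(x).\<close>

lemma pencil_module_nonneg:
  assumes "x \<in> spectrahedron A" "p \<in> pencil_module A"
  shows "0 \<le> eval_poly p x"
proof -
  obtain qs vs where p: "p = (\<Sum>q\<leftarrow>qs. q\<^sup>2) + (\<Sum>v\<leftarrow>vs. quad_form A v)"
    using assms(2) by (auto simp: pencil_module_def sums_of_squares_def)
  have "0 \<le> eval_poly (quad_form A v) x" for v
    using assms(1) by (simp add: eval_quad_form spectrahedron_def pos_semidef_def)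
  then show ?thesis
    by (auto simp: p eval_poly_add eval_poly_sum_list eval_poly_power intro!: add_nonneg_nonneg sum_list_nonneg)
qed

text \<open>Some power of p is both nonnegative and nonpositive at x.\<close>

lemma radical_support_vanishes:
  assumes "x \<in> spectrahedron A" "p \<in> ideal_radical (module_support (pencil_module A))"
  shows "eval_poly p x = 0"
proof -
  obtain k where "p ^ k \<in> pencil_module A" "- (p ^ k) \<in> pencil_module A"
    using assms(2) by (force simp: ideal_radical_def module_support_def)
  then have "eval_poly (p ^ k) x = 0"
    using pencil_module_nonneg[OF assms(1), of "p ^ k"] pencil_module_nonneg[OF assms(1), of "- (p ^ k)"]
    by (simp add: eval_poly_minus)
  then show ?thesis by (simp add: eval_poly_power)
qed

section \<open>Separation from the radical\<close>

lemma continuous_coeff_vec_quad_form: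
  "continuous_on S (\<lambda>u. coeff_vec (quad_form A (const_vec u)))"
proof -
  have "coeff_vec (quad_form A (const_vec u))
      = (\<Sum>i\<in>UNIV. \<Sum>j\<in>UNIV. (u $ i * u $ j) *\<^sub>R coeff_vec (A $ i $ j))" for u
    by (simp add: quad_form_sum const_vec_def coeff_vec_sum coeff_vec_scale flip: const_poly_simps)
  then show ?thesis by (simp only:) (intro continuous_intros)
qed

text \<open>Strict separation of a compact convex set from the affine part of the radical yields a
  functional that is positive on the constant \<open>1\<close>, hence is, up to scaling, evaluation at a point.
  So no separate argument is needed for an empty spectrahedron.\<close>

lemma exists_negative_point:
  fixes A :: "'n::finite rpoly ^ 'a::finite ^ 'a"
  assumes pencil: "linear_pencil A" and f: "f \<in> polys_deg_le 1"
    and notin: "f \<notin> pencil_cone A + ideal_radical (module_support (pencil_module A))"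
  shows "\<exists>x\<in>spectrahedron A. eval_poly f x < 0"
proof -
  interpret quadratic_module "pencil_module A" "const_poly (1/2)"
    by (rule quadratic_module_pencil)
  have sym: "transpose A = A" using pencil by (simp add: linear_pencil_def)
  let ?q = "\<lambda>u. quad_form A (const_vec u)"
  \<comment> \<open>Otherwise the radical is the whole ring and f = 0 + f is a forbidden
    decomposition.\<close>
  have one: "1 \<notin> nil"
  proof
    assume "1 \<in> nil"
    then have "f \<in> nil" using nil_mult[of 1 f] by simp
    moreover have "0 \<in> pencil_cone A"
      using pencil_cone_const[of 0 A] by (simp add: const_poly_simps)
    ultimately show False
      using notin set_plus_intro[of 0 _ f] by force
  qed
  \<comment> \<open>By \<open>nil_matrix_vector\<close>, U contains every u with u* A u in the
    radical; the condition on A u is linear in u, which makes U a subspace.\<close>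
  define U where "U = {u. \<forall>i. (A *v const_vec u) $ i \<in> nil}"
  have "subspace U"
    by (auto simp: subspace_def U_def const_vec_add const_vec_scaleR matrix_vector_right_distrib
        matrix_vector_mult_scale_nth nil_add nil_mult)
      (simp add: const_vec_def matrix_vector_mult_def const_poly_simps nil_zero)
  define P where "P = {w. \<forall>u\<in>U. orthogonal u w}"
  have P: "subspace P" unfolding P_def by (rule subspace_orthogonal_to_vectors)
  \<comment> \<open>Split u = y + w along U and its orthogonal complement: the form at y and the
    cross term lie in the radical.\<close>
  have reduce: "\<exists>w\<in>P. ?q u - ?q w \<in> nil" for u
  proof -
    obtain y w where y: "y \<in> span U" and w: "\<And>z. z \<in> span U \<Longrightarrow> orthogonal w z" and u: "u = y + w"
      using orthogonal_subspace_decomp_exists[of U u] by metis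
    have "y \<in> U" using y \<open>subspace U\<close> by (metis span_eq_iff)
    then have "(\<Sum>i\<in>UNIV. v $ i * (A *v const_vec y) $ i) \<in> nil" for v
      by (auto simp: U_def intro!: nil_sum nil_mult)
    then have "?q y \<in> nil" "2 * (\<Sum>i\<in>UNIV. const_vec w $ i * (A *v const_vec y) $ i) \<in> nil"
      by (auto simp: quad_form_def intro: nil_mult)
    then have "?q u - ?q w \<in> nil"
      by (simp add: u const_vec_add quad_form_add[OF sym] nil_add)
    moreover have "w \<in> P"
      using w by (auto simp: P_def orthogonal_commute span_base)
    ultimately show ?thesis by auto
  qed
  \<comment> \<open>Restricting to unit vectors gives compactness; including 1 makes K nonempty and
    will force the separating functional to be positive at 1.\<close>
  define K where "K = insert (coeff_vec 1) ((\<lambda>u. coeff_vec (?q u)) ` (P \<inter> sphere 0 1))"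
  define D where "D = {p \<in> pencil_cone A. p \<notin> nil}"
  have "compact K"
    unfolding K_def
    by (intro compact_insert compact_continuous_image continuous_coeff_vec_quad_form
        closed_Int_compact closed_subspace P compact_sphere)
  have "K \<subseteq> coeff_vec ` D"
  proof -
    have "1 \<in> D" using one pencil_cone_const[of 1 A] by (simp add: D_def const_poly_simps)
    moreover have "?q u \<in> D" if "u \<in> P" "norm u = 1" for u
    proof -
      \<comment> \<open>Otherwise u lies in U and in its orthogonal complement, so u = 0.\<close>
      have "?q u \<notin> nil"
      proof
        assume "?q u \<in> nil"
        then have "u \<in> U"
          using nil_matrix_vector[OF sym quad_form_in_pencil_module] by (simp add: U_def)
        then have "orthogonal u u" using that(1) by (simp add: P_def)
        then show False using that(2) by (simp add: orthogonal_self)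
      qed
      then show ?thesis by (simp add: D_def quad_form_in_pencil_cone)
    qed
    ultimately show ?thesis by (auto simp: K_def)
  qed
  moreover have "convex (coeff_vec ` D)"
  proof (rule convexI)
    fix x y and s t :: real
    assume "x \<in> coeff_vec ` D" "y \<in> coeff_vec ` D" and st: "0 \<le> s" "0 \<le> t" "s + t = 1"
    then obtain p q where p: "p \<in> D" "x = coeff_vec p" and q: "q \<in> D" "y = coeff_vec q" by auto
    have C: "const_poly s * p \<in> pencil_cone A" "const_poly t * q \<in> pencil_cone A"
      using p q st by (auto simp: D_def pencil_cone_scale)
    have cancel: "r \<in> nil" if "c \<noteq> 0" "const_poly c * r \<in> nil" for c and r :: "'n rpoly"
    proof -
      have "r = const_poly (1 / c) * (const_poly c * r)"
        using that(1) by (simp add: const_poly_simps(2) flip: mult.assoc const_poly_simps(5))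
      then show ?thesis using nil_mult[OF that(2)] by metis
    qed
    \<comment> \<open>By \<open>nil_summand\<close> both weighted summands would lie in the radical,
      and a nonzero weight can be cancelled.\<close>
    have "const_poly s * p + const_poly t * q \<notin> nil"
    proof
      assume *: "const_poly s * p + const_poly t * q \<in> nil"
      have "const_poly s * p \<in> nil" "const_poly t * q \<in> nil"
        using nil_summand[of "const_poly s * p" "const_poly t * q"]
          nil_summand[of "const_poly t * q" "const_poly s * p"] C * pencil_cone_subset_module
        by (auto simp: add.commute)
      moreover have "s \<noteq> 0 \<or> t \<noteq> 0" using st by auto
      ultimately show False using cancel p(1) q(1) by (auto simp: D_def)
    qed
    then have "const_poly s * p + const_poly t * q \<in> D"
      using C by (simp add: D_def pencil_cone_add)
    then show "s *\<^sub>R x + t *\<^sub>R y \<in> coeff_vec ` D"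
      by (auto simp: p(2) q(2) coeff_vec_add coeff_vec_scale intro!: image_eqI)
  qed
  ultimately have hull: "convex hull K \<subseteq> coeff_vec ` D" by (rule hull_minimal)
  \<comment> \<open>Adding -f as a generator makes the functional negative at f.\<close>
  define T where "T = convex hull (insert (- coeff_vec f) K)"
  define V where "V = coeff_vec ` (nil \<inter> polys_deg_le 1)"
  have V: "subspace V"
    unfolding subspace_def
  proof (intro conjI ballI allI)
    show "0 \<in> V" unfolding V_def
      by (rule image_eqI[of _ _ 0]) (auto simp: coeff_vec_zero nil_zero affine_zero)
    show "x + y \<in> V" if xy: "x \<in> V" "y \<in> V" for x y
    proof -
      obtain p q where "p \<in> nil \<inter> polys_deg_le 1" "q \<in> nil \<inter> polys_deg_le 1"
        "x = coeff_vec p" "y = coeff_vec q" using xy unfolding V_def by auto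
      then show ?thesis unfolding V_def
        by (intro image_eqI[of _ _ "p + q"]) (auto simp: coeff_vec_add nil_add affine_add)
    qed
    show "c *\<^sub>R x \<in> V" if x: "x \<in> V" for c x
    proof -
      obtain p where "p \<in> nil \<inter> polys_deg_le 1" "x = coeff_vec p" using x unfolding V_def by auto
      then show ?thesis unfolding V_def
        by (intro image_eqI[of _ _ "const_poly c * p"])
          (auto simp: coeff_vec_scale nil_mult affine_scale)
    qed
  qed
  have "V \<inter> T = {}"
  proof (rule ccontr)
    assume "V \<inter> T \<noteq> {}"
    then obtain g where g: "g \<in> nil" "g \<in> polys_deg_le 1" and gT: "coeff_vec g \<in> T"
      unfolding V_def by blast
    have "K \<noteq> {}" by (simp add: K_def)
    with gT obtain r v b where rv: "0 \<le> r" "0 \<le> v" "r + v = 1" and b: "b \<in> convex hull K"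
      and eq: "coeff_vec g = r *\<^sub>R (- coeff_vec f) + v *\<^sub>R b"
      unfolding T_def convex_hull_insert[OF \<open>K \<noteq> {}\<close>] by blast
    obtain p where p: "p \<in> D" "b = coeff_vec p" using b hull by auto
    then have pC: "p \<in> pencil_cone A" by (simp add: D_def)
    have "coeff_vec g = coeff_vec (const_poly (- r) * f + const_poly v * p)"
      by (simp add: eq p(2) coeff_vec_add coeff_vec_scale)
    \<comment> \<open>A common point gives g = -r f + v p with p in D. If r = 0 then g = p, which is
      outside the radical; otherwise solving for f puts it in the cone plus the radical.\<close>
    then have g_eq: "g = const_poly (- r) * f + const_poly v * p"
      using pC affine_pencil_cone[OF pencil]
      by (intro coeff_vec_inj) (auto simp del: One_nat_def intro!: g affine_add affine_scale f)
    show False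
    proof (cases "r = 0")
      case True
      then have "g = p" using rv by (simp add: g_eq const_poly_simps)
      then show False using g p by (simp add: D_def)
    next
      case False
      have "f = const_poly (v / r) * p + const_poly (- 1 / r) * g"
      proof (rule poly_mapping_eqI)
        fix m
        show "Poly_Mapping.lookup f m
            = Poly_Mapping.lookup (const_poly (v / r) * p + const_poly (- 1 / r) * g) m"
          unfolding g_eq lookup_add lookup_const_poly_mult
          using False by (simp add: field_simps)
      qed
      moreover have "const_poly (v / r) * p \<in> pencil_cone A"
        using rv pC by (simp add: pencil_cone_scale)
      moreover have "const_poly (- 1 / r) * g \<in> nil" using g by (simp add: nil_mult)
      ultimately show False using notin by (metis set_plus_intro)
    qed
  qed
  moreover have "compact T" unfolding T_def
    using \<open>compact K\<close> by (intro compact_convex_hull compact_insert)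
  moreover have "T \<noteq> {}" "convex T" by (simp_all add: T_def)
  moreover have "closed V" "convex V" using V by (simp_all add: closed_subspace subspace_imp_convex)
  ultimately obtain a b where ab: "\<And>x. x \<in> V \<Longrightarrow> a \<bullet> x < b" "\<And>x. x \<in> T \<Longrightarrow> b < a \<bullet> x"
    using separating_hyperplane_closed_compact[of V T] by metis
  have "0 < b" using ab(1)[of 0] V by (simp add: subspace_0)
  \<comment> \<open>A linear functional bounded above on a subspace vanishes there: otherwise a
    multiple of x would attain the bound b.\<close>
  have aV: "a \<bullet> x = 0" if "x \<in> V" for x
  proof (rule ccontr)
    assume "a \<bullet> x \<noteq> 0"
    then have "a \<bullet> ((b / (a \<bullet> x)) *\<^sub>R x) = b" by simp
    then show False using ab(1)[of "(b / (a \<bullet> x)) *\<^sub>R x"] V that by (simp add: subspace_scale)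
  qed
  have aT: "0 < a \<bullet> x" if "x \<in> insert (- coeff_vec f) K" for x
    using ab(2)[of x] \<open>0 < b\<close> hull_inc[OF that, of convex] by (simp add: T_def)
  have afst: "0 < fst a"
    using aT[of "coeff_vec 1"]
    by (simp add: K_def coeff_vec_one inner_prod_def)
  \<comment> \<open>Modulo V the vector u may be replaced by some w in P, and a nonzero w by its
    normalisation, whose form is a generator in K.\<close>
  have quad: "0 \<le> a \<bullet> coeff_vec (?q u)" for u
  proof -
    obtain w where w: "w \<in> P" "?q u - ?q w \<in> nil" using reduce by blast
    then have "coeff_vec (?q u - ?q w) \<in> V"
      using affine_quad_form[OF pencil] affine_add[of "?q u" 1 "- ?q w"]
      by (auto simp: V_def affine_minus)
    from aV[OF this] have "a \<bullet> coeff_vec (?q u) = a \<bullet> coeff_vec (?q w)"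
      using coeff_vec_add[of "?q u" "- ?q w"] by (simp add: coeff_vec_minus inner_diff_right)
    also have "0 \<le> \<dots>"
    proof (cases "w = 0")
      case True
      then show ?thesis
        by (simp add: quad_form_sum const_vec_def const_poly_simps coeff_vec_zero)
    next
      case False
      define z where "z = (1 / norm w) *\<^sub>R w"
      have "w = norm w *\<^sub>R z" using False by (simp add: z_def)
      then have "?q w = (const_poly (norm w))\<^sup>2 * ?q z"
        by (metis const_vec_scaleR quad_form_scale)
      then have "coeff_vec (?q w) = (norm w)\<^sup>2 *\<^sub>R coeff_vec (?q z)"
        by (simp add: power2_eq_square coeff_vec_scale flip: const_poly_simps)
      moreover have "z \<in> P \<inter> sphere 0 1"
        using False w(1) P by (simp add: z_def subspace_scale)
      then have "0 < a \<bullet> coeff_vec (?q z)" by (intro aT) (auto simp: K_def)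
      ultimately show ?thesis by simp
    qed
    finally show ?thesis .
  qed
  \<comment> \<open>Dividing by the positive number \<open>fst a\<close> turns the functional a into
    (1, x), which is evaluation at x.\<close>
  define x where "x = (1 / fst a) *\<^sub>R snd a"
  have eval: "eval_poly p x = (a \<bullet> coeff_vec p) / fst a" if "p \<in> polys_deg_le 1" for p
    using afst by (simp add: eval_affine[OF that] x_def inner_prod_def inner_commute field_simps)
  have "x \<in> spectrahedron A"
  proof -
    have "transpose (eval_pencil A x) = eval_pencil A x"
      by (simp add: eval_pencil_def transpose_def vec_eq_iff transpose_eq_selfD[OF sym])
    moreover have "0 \<le> u \<bullet> (eval_pencil A x *v u)" for u
      using quad[of u] afst eval[OF affine_quad_form[OF pencil, of u]]
      by (simp flip: eval_quad_form_const)
    ultimately show ?thesis by (simp add: spectrahedron_def pos_semidef_def)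
  qed
  moreover have "eval_poly f x < 0"
    using aT[of "- coeff_vec f"] afst by (simp add: eval[OF f] divide_neg_pos)
  ultimately show ?thesis by blast
qed

theorem corollary4p2p3:
  fixes A :: "'n::finite rpoly ^ 'a::finite ^ 'a"
  assumes "linear_pencil A"
  shows "\<forall>f\<in>polys_deg_le 1.
           (\<forall>x\<in>spectrahedron A. 0 \<le> eval_poly f x) \<longleftrightarrow>
           f \<in> pencil_cone A + ideal_radical (module_support (pencil_module A))"
proof (intro ballI iffI)
  fix f :: "'n rpoly"
  assume "f \<in> polys_deg_le 1" "\<forall>x\<in>spectrahedron A. 0 \<le> eval_poly f x"
  then show "f \<in> pencil_cone A + ideal_radical (module_support (pencil_module A))"
    using exists_negative_point[OF assms] by (meson not_le)
next
  fix f :: "'n rpoly" and x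
  assume "f \<in> pencil_cone A + ideal_radical (module_support (pencil_module A))"
    and x: "x \<in> spectrahedron A"
  then obtain p g where "f = p + g" "p \<in> pencil_module A"
    "g \<in> ideal_radical (module_support (pencil_module A))"
    using pencil_cone_subset_module by (auto elim!: set_plus_elim)
  then show "0 \<le> eval_poly f x"
    using pencil_module_nonneg[OF x] radical_support_vanishes[OF x] by (simp add: eval_poly_add)
qed

end
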